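(* Let $A_1=\{231,312,4321,21543\}$. A permutation belongs to $\operatorname{Av}(A_1)$ if and only if it is of the form $\pi\oplus\sigma\oplus\tau$, where $\pi$ is an increasing permutation (possibly empty), $\sigma$ is either empty or equal to $321$, and $\tau$ is a Fibonacci permutation (possibly empty).
   Context: For a set $S$ of permutations, $\operatorname{Av}(S)$ is the set of all permutations avoiding every pattern in $S$ (in the classical sense: no subsequence is order isomorphic to the pattern). A Fibonacci permutation is a permutation in $\operatorname{Av}(231,312,321)$. For permutations $\pi$ of length $n$ and $\sigma$ of length $k$, $\pi\oplus\sigma$ is $\pi$ followed by $\sigma$ with every entry of $\sigma$ increased by $n$; $\pi\ominus\sigma$ is $\pi$ followed by $\sigma$ with every entry of $\pi$ increased by $k$. *)

theory Defs
  imports "HOL-Library.Sublist" "HOL-Combinatorics.Multiset_Permutations"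
begin

text \<open>
  Permutations are written in one-line notation, as lists of natural numbers: a permutation of
  length \<open>n\<close> lists each of \<open>1, \<dots>, n\<close> exactly once. The empty list is the permutation of length 0.
\<close>

definition is_perm :: "nat list \<Rightarrow> bool" where
  "is_perm p \<longleftrightarrow> p \<in> permutations_of_set {1..length p}"

definition order_isomorphic :: "nat list \<Rightarrow> nat list \<Rightarrow> bool" where
  "order_isomorphic xs ys \<longleftrightarrow> length xs = length ys \<and>
     (\<forall>i < length xs. \<forall>j < length xs. xs ! i < xs ! j \<longleftrightarrow> ys ! i < ys ! j)"

text \<open>Subsequences need not be contiguous; this is what \<^const>\<open>subseq\<close> means.\<close>

definition contains_pattern :: "nat list \<Rightarrow> nat list \<Rightarrow> bool" where
  "contains_pattern p s \<longleftrightarrow> (\<exists>xs. subseq xs p \<and> order_isomorphic xs s)"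

definition Av :: "nat list set \<Rightarrow> nat list set" where
  "Av S = {p. is_perm p \<and> (\<forall>s \<in> S. \<not> contains_pattern p s)}"

definition fibonacci_perm :: "nat list \<Rightarrow> bool" where
  "fibonacci_perm p \<longleftrightarrow> p \<in> Av {[2,3,1], [3,1,2], [3,2,1]}"

definition direct_sum :: "nat list \<Rightarrow> nat list \<Rightarrow> nat list"  (infixl "\<oplus>" 65) where
  "p \<oplus> s = p @ map (\<lambda>x. x + length p) s"

definition A1 :: "nat list set" where
  "A1 = {[2,3,1], [3,1,2], [4,3,2,1], [2,1,5,4,3]}"

end

theory Submission
  imports Defs
begin

text \<open>
  A permutation avoiding 231 and 312 is layered: if it begins with \<open>x\<close>, then the entries below
  \<open>x\<close> decrease (312) and precede the entries above \<open>x\<close> (231), so it is \<open>x \<dots> 1 \<oplus> q\<close>. Peel off this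
  first layer. If \<open>x = 1\<close> it is absorbed into the increasing part; 4321 excludes \<open>x \<ge> 4\<close>; and if
  \<open>x \<in> {2, 3}\<close> then 21543 forces \<open>q\<close> to avoid 321.
\<close>

section \<open>Direct sums and invariance of pattern containment under shifts\<close>

lemma is_perm_iff: "is_perm p \<longleftrightarrow> distinct p \<and> set p = {1..length p}"
  by (auto simp: is_perm_def permutations_of_set_def)

lemma length_direct_sum [simp]: "length (p \<oplus> s) = length p + length s"
  by (simp add: direct_sum_def)

lemma direct_sum_Nil_left [simp]: "[] \<oplus> s = s"
  by (simp add: direct_sum_def)

lemma direct_sum_assoc: "p \<oplus> s \<oplus> t = p \<oplus> (s \<oplus> t)"
  by (simp add: direct_sum_def add.assoc add.commute[of "length s"])

text \<open>The values of \<open>u\<close> are exactly \<open>1\<close> to \<open>length u\<close>,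
  and distinctness of the sum makes the shifted values of \<open>q\<close> disjoint from them. These
  therefore fill the rest of the interval.\<close>

lemma is_perm_direct_sumD:
  assumes "is_perm (u \<oplus> q)" "is_perm u"
  shows "is_perm q"
proof -
  have sets: "set u = {1..length u}"
    "set u \<union> (\<lambda>x. x + length u) ` set q = {1..length u + length q}"
    "set u \<inter> (\<lambda>x. x + length u) ` set q = {}" and dist: "distinct q"
    using assms by (auto simp: is_perm_iff direct_sum_def distinct_map)
  have "y \<in> set q \<longleftrightarrow> y \<in> {1..length q}" for y
  proof -
    have "y \<in> set q \<longleftrightarrow> y + length u \<in> (\<lambda>x. x + length u) ` set q"
      by auto
    also have "\<dots> \<longleftrightarrow> y + length u \<in> {1..length u + length q} - {1..length u}"
      using sets by blast
    also have "\<dots> \<longleftrightarrow> y \<in> {1..length q}"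
      by auto
    finally show ?thesis .
  qed
  then have "set q = {1..length q}"
    by (rule set_eqI)
  with dist show ?thesis
    by (simp add: is_perm_iff)
qed

lemma is_perm_Cons_1: "is_perm \<pi> \<Longrightarrow> is_perm ([1] \<oplus> \<pi>)"
  by (auto simp: is_perm_iff direct_sum_def distinct_map image_Suc_atLeastAtMost)

lemma order_isomorphic_shift:
  "order_isomorphic (map (\<lambda>x. x + n) xs) s \<longleftrightarrow> order_isomorphic xs s"
  by (auto simp: order_isomorphic_def)

lemma contains_pattern_shift:
  "contains_pattern (map (\<lambda>x. x + n) p) s \<longleftrightarrow> contains_pattern p s"
proof
  assume "contains_pattern (map (\<lambda>x. x + n) p) s"
  then obtain xs where xs: "subseq xs (map (\<lambda>x. x + n) p)" "order_isomorphic xs s"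
    by (auto simp: contains_pattern_def)
  \<comment> \<open>Selecting the same positions \<open>N\<close> in the unshifted list gives the
    preimage of \<open>xs\<close>.\<close>
  then obtain N where "xs = map (\<lambda>x. x + n) (nths p N)" "subseq (nths p N) p"
    by (auto simp: subseq_conv_nths nths_map)
  with xs show "contains_pattern p s"
    unfolding contains_pattern_def by (auto simp: order_isomorphic_shift)
next
  assume "contains_pattern p s"
  then obtain xs where "subseq xs p" "order_isomorphic xs s"
    by (auto simp: contains_pattern_def)
  then show "contains_pattern (map (\<lambda>x. x + n) p) s"
    unfolding contains_pattern_def
    by (intro exI[of _ "map (\<lambda>x. x + n) xs"]) (simp add: order_isomorphic_shift subseq_map)
qed

lemma contains_pattern_mono:
  "subseq p q \<Longrightarrow> contains_pattern p s \<Longrightarrow> contains_pattern q s"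
  unfolding contains_pattern_def by (meson subseq_order.trans)

lemma contains_pattern_direct_sum_right:
  "contains_pattern q s \<Longrightarrow> contains_pattern (u \<oplus> q) s"
  unfolding direct_sum_def
  by (rule contains_pattern_mono[of "map (\<lambda>x. x + length u) q"])
    (simp_all add: contains_pattern_shift list_emb_append2)

lemma Av_direct_sumD:
  "u \<oplus> q \<in> Av S \<Longrightarrow> is_perm u \<Longrightarrow> q \<in> Av S"
  using is_perm_direct_sumD contains_pattern_direct_sum_right by (auto simp: Av_def)

section \<open>Concrete patterns as chains of inequalities\<close>

lemma order_isomorphic_Nil_right [simp]: "order_isomorphic xs [] \<longleftrightarrow> xs = []"
  by (auto simp: order_isomorphic_def)

text \<open>As a rewrite rule this peels a literal pattern down to \<open>[]\<close>, leaving
  finitely many comparisons of numerals for the simplifier.\<close>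

lemma order_isomorphic_Cons_right:
  "order_isomorphic xs (y # ys) \<longleftrightarrow> (\<exists>x zs. xs = x # zs \<and> order_isomorphic zs ys \<and>
     (\<forall>(a, b) \<in> set (zip zs ys). (x < a \<longleftrightarrow> y < b) \<and> (a < x \<longleftrightarrow> b < y)))"
proof (cases xs)
  case (Cons x zs)
  have "(\<forall>(a, b) \<in> set (zip zs ys). (x < a \<longleftrightarrow> y < b) \<and> (a < x \<longleftrightarrow> b < y)) \<longleftrightarrow>
      (\<forall>i < length ys. (x < zs ! i \<longleftrightarrow> y < ys ! i) \<and> (zs ! i < x \<longleftrightarrow> ys ! i < y))"
    if "length zs = length ys"
    using that unfolding set_zip by force
  then show ?thesis
    unfolding Cons order_isomorphic_def
    by (simp add: All_less_Suc2 cong: conj_cong) blast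
qed (simp add: order_isomorphic_def)

text \<open>Comparing entries that are neighbours in value suffices, as transitivity gives the rest.
  The same holds for the four analogous lemmas below.\<close>

lemma contains_231_iff:
  "contains_pattern p [2,3,1] \<longleftrightarrow> (\<exists>a b c. subseq [a,b,c] p \<and> c < a \<and> a < b)"
proof -
  have "order_isomorphic xs [2,3,1] \<longleftrightarrow> (\<exists>a b c. xs = [a,b,c] \<and> c < a \<and> a < b)" for xs
    by (auto simp: order_isomorphic_Cons_right)
  then show ?thesis
    by (simp only: contains_pattern_def) fast
qed

lemma contains_312_iff:
  "contains_pattern p [3,1,2] \<longleftrightarrow> (\<exists>a b c. subseq [a,b,c] p \<and> b < c \<and> c < a)"
proof -
  have "order_isomorphic xs [3,1,2] \<longleftrightarrow> (\<exists>a b c. xs = [a,b,c] \<and> b < c \<and> c < a)" for xs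
    by (auto simp: order_isomorphic_Cons_right)
  then show ?thesis
    by (simp only: contains_pattern_def) fast
qed

lemma contains_321_iff:
  "contains_pattern p [3,2,1] \<longleftrightarrow> (\<exists>a b c. subseq [a,b,c] p \<and> c < b \<and> b < a)"
proof -
  have "order_isomorphic xs [3,2,1] \<longleftrightarrow> (\<exists>a b c. xs = [a,b,c] \<and> c < b \<and> b < a)" for xs
    by (auto simp: order_isomorphic_Cons_right)
  then show ?thesis
    by (simp only: contains_pattern_def) fast
qed

lemma contains_4321_iff:
  "contains_pattern p [4,3,2,1] \<longleftrightarrow>
    (\<exists>a b c d. subseq [a,b,c,d] p \<and> d < c \<and> c < b \<and> b < a)"
proof -
  have "order_isomorphic xs [4,3,2,1] \<longleftrightarrow> (\<exists>a b c d. xs = [a,b,c,d] \<and> d < c \<and> c < b \<and> b < a)" for xs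
    by (auto simp: order_isomorphic_Cons_right)
  then show ?thesis
    by (simp only: contains_pattern_def) fast
qed

lemma contains_21543_iff:
  "contains_pattern p [2,1,5,4,3] \<longleftrightarrow>
    (\<exists>a b c d e. subseq [a,b,c,d,e] p \<and> b < a \<and> a < e \<and> e < d \<and> d < c)"
proof -
  have "order_isomorphic xs [2,1,5,4,3] \<longleftrightarrow>
      (\<exists>a b c d e. xs = [a,b,c,d,e] \<and> b < a \<and> a < e \<and> e < d \<and> d < c)" for xs
    by (auto simp: order_isomorphic_Cons_right)
  then show ?thesis
    by (simp only: contains_pattern_def) fast
qed

section \<open>Splitting off the first layer\<close>

lemma subseq_setD: "subseq xs ys \<Longrightarrow> x \<in> set xs \<Longrightarrow> x \<in> set ys"
  by (meson subseq_order.trans subseq_singleton_left)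

text \<open>This reduces an ordering claim about a tail to two-entry subsequences; putting the head
  in front of one gives a candidate occurrence of a three-letter pattern.\<close>

lemma sorted_wrt_iff_subseq: "sorted_wrt P xs \<longleftrightarrow> (\<forall>a b. subseq [a,b] xs \<longrightarrow> P a b)"
proof (induction xs)
  case (Cons x xs)
  have "subseq [a,b] (x # xs) \<longleftrightarrow> a = x \<and> b \<in> set xs \<or> subseq [a,b] xs" for a b
    using subseq_setD[of "[x,b]" xs b] by (auto simp: subseq_singleton_left)
  with Cons show ?case
    by (simp only: sorted_wrt.simps) blast
qed simp

text \<open>Under the hypothesis no entry failing \<open>Q\<close> precedes one satisfying it, so
  the entries satisfying \<open>Q\<close> form a prefix.\<close>

lemma partition_if_sorted_wrt:
  "sorted_wrt (\<lambda>a b. Q b \<longrightarrow> Q a) xs \<Longrightarrow> filter Q xs @ filter (\<lambda>x. \<not> Q x) xs = xs"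
proof (induction xs)
  case (Cons x xs)
  then show ?case
    by (cases "Q x") (auto simp: filter_empty_conv filter_id_conv)
qed simp

lemma first_layer:
  assumes perm: "is_perm (x # r)"
    and av: "\<not> contains_pattern (x # r) [2,3,1]" "\<not> contains_pattern (x # r) [3,1,2]"
  obtains q where "x # r = rev [1..<Suc x] \<oplus> q"
proof -
  define low where "low = filter (\<lambda>y. y < x) r"
  define high where "high = filter (\<lambda>y. \<not> y < x) r"
  have sets: "distinct (x # r)" "insert x (set r) = {1..Suc (length r)}"
    using perm by (auto simp: is_perm_iff)
  then have "x \<in> {1..Suc (length r)}"
    by blast
  have "sorted_wrt (\<lambda>a b. b < x \<longrightarrow> a < x) r"
    unfolding sorted_wrt_iff_subseq
  proof (intro allI impI)
    fix a b assume "subseq [a,b] r" "b < x"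
    then have "subseq [x,a,b] (x # r)" "a \<in> set r"
      using subseq_setD[of "[a,b]" r a] by simp_all
    \<comment> \<open>Otherwise \<open>b < x < a\<close>, and \<open>x, a, b\<close> would be an
      occurrence of 231.\<close>
    then have "\<not> x < a"
      using av(1) \<open>b < x\<close> unfolding contains_231_iff by blast
    with \<open>a \<in> set r\<close> sets(1) show "a < x"
      by (metis distinct.simps(2) linorder_neqE_nat)
  qed
  then have r: "r = low @ high"
    unfolding low_def high_def by (rule partition_if_sorted_wrt[symmetric])
  have "sorted_wrt (\<lambda>a b. b \<le> a) low"
    unfolding sorted_wrt_iff_subseq
  proof (intro allI impI)
    fix a b assume ab: "subseq [a,b] low"
    then have "b < x"
      using subseq_setD[OF ab, of b] by (simp add: low_def)
    moreover have "subseq [x,a,b] (x # r)"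
      using ab r by (simp add: list_emb_prefix)
    \<comment> \<open>If \<open>a < b\<close>, then \<open>a < b < x\<close> would make
      \<open>x, a, b\<close> an occurrence of 312.\<close>
    ultimately show "b \<le> a"
      using av(2) unfolding contains_312_iff by (meson not_le)
  qed
  then have "sorted (rev low)"
    by (simp add: sorted_wrt_rev)
  moreover have "set low = {1..<x}"
    using sets \<open>x \<in> _\<close> by (auto simp: low_def)
  ultimately have "rev low = [1..<x]"
    using sets by (intro sorted_distinct_set_unique) (auto simp: low_def)
  then have low: "low = rev [1..<x]"
    by (metis rev_rev_ident)
  \<comment> \<open>Subtraction on naturals truncates, so this bound is what lets the shift by
    \<open>x\<close> be undone and redone.\<close>
  have "x < y" if "y \<in> set high" for y
    using that sets by (force simp: high_def)
  then have "map (\<lambda>y. y + x) (map (\<lambda>y. y - x) high) = high"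
    by (auto simp: o_def less_imp_le intro!: map_idI)
  then have "x # r = rev [1..<Suc x] \<oplus> map (\<lambda>y. y - x) high"
    using r low \<open>x \<in> _\<close> by (simp add: direct_sum_def del: map_map)
  then show thesis ..
qed

section \<open>Sums of the stated form avoid the four patterns\<close>

text \<open>An occurrence of \<open>s\<close> starting inside \<pi> would have no later entry below
  its first, since \<pi> increases and nothing after it is smaller. As \<open>s\<close> does not
  start with its minimum, the occurrence lies wholly in the shifted \<open>w\<close>.\<close>

lemma contains_pattern_increasing_sum:
  assumes \<pi>: "is_perm \<pi>" "sorted_wrt (<) \<pi>"
    and s: "j < length s" "s ! j < s ! 0"
    and con: "contains_pattern (\<pi> \<oplus> w) s"
  shows "contains_pattern w s"
proof -
  obtain xs where xs: "subseq xs (\<pi> \<oplus> w)" "order_isomorphic xs s"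
    using con by (auto simp: contains_pattern_def)
  have desc: "j < length xs" "xs ! j < xs ! 0"
    using xs(2) s unfolding order_isomorphic_def by (metis gr_zeroI less_irrefl order.strict_trans)+
  from xs(1) obtain us vs where xs_eq: "xs = us @ vs"
    and us: "subseq us \<pi>" and vs: "subseq vs (map (\<lambda>x. x + length \<pi>) w)"
    unfolding direct_sum_def by (auto elim: subseq_appendE)
  have "sorted_wrt (<) us"
    using us \<pi>(2) by (auto simp: sorted_wrt_iff_subseq intro: subseq_order.trans)
  \<comment> \<open>The inequality is weak because \<open>w\<close> is an arbitrary list and may
    contain \<open>0\<close>.\<close>
  moreover have "a \<le> b" if "a \<in> set us" "b \<in> set vs" for a b
    using that \<pi>(1) subseq_setD[OF us, of a] subseq_setD[OF vs, of b]
    by (auto simp: is_perm_iff)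
  ultimately have "us = []"
    using desc unfolding xs_eq
    by (cases us; cases j) (auto simp: nth_append not_less[symmetric] split: if_splits
        dest!: nth_mem)
  then show ?thesis
    using vs xs(2) xs_eq contains_pattern_shift[of "length \<pi>" w s]
    unfolding contains_pattern_def by auto
qed

lemma Av_A1_iff:
  "p \<in> Av A1 \<longleftrightarrow> is_perm p \<and> \<not> contains_pattern p [2,3,1] \<and> \<not> contains_pattern p [3,1,2] \<and>
     \<not> contains_pattern p [4,3,2,1] \<and> \<not> contains_pattern p [2,1,5,4,3]"
  by (auto simp: Av_def A1_def)

lemma fibonacci_perm_iff:
  "fibonacci_perm p \<longleftrightarrow> is_perm p \<and> \<not> contains_pattern p [2,3,1] \<and>
     \<not> contains_pattern p [3,1,2] \<and> \<not> contains_pattern p [3,2,1]"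
  by (auto simp: Av_def fibonacci_perm_def)

lemma contains_4321_imp_321: "contains_pattern p [4,3,2,1] \<Longrightarrow> contains_pattern p [3,2,1]"
  unfolding contains_4321_iff contains_321_iff by (meson subseq_Cons')

lemma contains_21543_imp_321: "contains_pattern p [2,1,5,4,3] \<Longrightarrow> contains_pattern p [3,2,1]"
  unfolding contains_21543_iff contains_321_iff by (meson subseq_Cons')

text \<open>Both longer patterns of \<open>A1\<close> contain 321: drop the first entry of 4321, or
  the first two of 21543.\<close>

lemma fibonacci_imp_Av_A1: "fibonacci_perm p \<Longrightarrow> p \<in> Av A1"
  unfolding fibonacci_perm_iff Av_A1_iff
  using contains_4321_imp_321 contains_21543_imp_321 by blast

text \<open>The cases are split by which entries of an occurrence lie in \<open>3, 2, 1\<close>; the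
  others form a suffix inside \<open>t\<close>, whose entries all exceed \<open>3\<close>. Whatever
  the order relations do not rule out yields 231, 312 or 321 within \<open>t\<close>.\<close>

lemma sum_321_fibonacci_avoids:
  assumes "fibonacci_perm \<tau>" "s \<in> A1"
  shows "\<not> contains_pattern ([3,2,1] \<oplus> \<tau>) s"
proof -
  define t where "t = map (\<lambda>x. x + 3) \<tau>"
  have w: "[3,2,1] \<oplus> \<tau> = 3 # 2 # 1 # t"
    by (simp add: direct_sum_def t_def)
  have big: "\<forall>y \<in> set xs. 3 < y" if "subseq xs t" for xs
    using subseq_setD[OF that] assms(1) by (force simp: t_def fibonacci_perm_iff is_perm_iff)
  have av: "\<not> (subseq [a,b,c] t \<and> c < a \<and> a < b)" "\<not> (subseq [a,b,c] t \<and> b < c \<and> c < a)"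
      "\<not> (subseq [a,b,c] t \<and> c < b \<and> b < a)" for a b c
    using assms(1)[unfolded fibonacci_perm_iff, folded contains_pattern_shift[of 3 \<tau>]]
    unfolding t_def contains_231_iff contains_312_iff contains_321_iff by blast+
  have "\<not> contains_pattern (3 # 2 # 1 # t) [2,3,1]"
  proof
    assume "contains_pattern (3 # 2 # 1 # t) [2,3,1]"
    then obtain a b c where "subseq [a,b,c] (3 # 2 # 1 # t)" "c < a \<and> a < b"
      unfolding contains_231_iff by blast
    then show False
      using big[of "[a,b,c]"] big[of "[b,c]"] big[of "[c]"]
      by (simp split: if_split_asm) (use av(1) in blast)+
  qed
  moreover have "\<not> contains_pattern (3 # 2 # 1 # t) [3,1,2]"
  proof
    assume "contains_pattern (3 # 2 # 1 # t) [3,1,2]"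
    then obtain a b c where "subseq [a,b,c] (3 # 2 # 1 # t)" "b < c \<and> c < a"
      unfolding contains_312_iff by blast
    then show False
      using big[of "[a,b,c]"] big[of "[b,c]"] big[of "[c]"]
      by (simp split: if_split_asm) (use av(2) in blast)+
  qed
  moreover have "\<not> contains_pattern (3 # 2 # 1 # t) [4,3,2,1]"
  proof
    assume "contains_pattern (3 # 2 # 1 # t) [4,3,2,1]"
    then obtain a b c d where "subseq [a,b,c,d] (3 # 2 # 1 # t)" "d < c \<and> c < b \<and> b < a"
      unfolding contains_4321_iff by blast
    \<comment> \<open>Four entries do not fit into \<open>3, 2, 1\<close>, and a descending sequence
      cannot pass from there into \<open>t\<close>. An occurrence inside \<open>t\<close> becomes a
      321 once its first entry is dropped.\<close>
    then show False
      using big[of "[a,b,c,d]"] big[of "[b,c,d]"] big[of "[c,d]"] big[of "[d]"]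
        subseq_Cons'[of a "[b,c,d]" t]
      by (simp split: if_split_asm) (use av(3) in blast)+
  qed
  moreover have "\<not> contains_pattern (3 # 2 # 1 # t) [2,1,5,4,3]"
  proof
    assume "contains_pattern (3 # 2 # 1 # t) [2,1,5,4,3]"
    then obtain a b c d e where "subseq [a,b,c,d,e] (3 # 2 # 1 # t)" "b < a \<and> a < e \<and> e < d \<and> d < c"
      unfolding contains_21543_iff by blast
    \<comment> \<open>The entry playing 5 exceeds an earlier one, so it cannot lie in the decreasing
      \<open>3, 2, 1\<close>. Hence the entries playing 543 form a 321 in \<open>t\<close>.\<close>
    then show False
      using big[of "[a,b,c,d,e]"] big[of "[b,c,d,e]"] big[of "[c,d,e]"] big[of "[d,e]"] big[of "[e]"]
        subseq_Cons'[of a "[b,c,d,e]" t]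
        subseq_Cons'[of b "[c,d,e]" t]
      by (simp split: if_split_asm) (use av(3) in blast)+
  qed
  ultimately show ?thesis
    using assms(2) unfolding w A1_def by auto
qed

section \<open>Every permutation in the class decomposes\<close>

text \<open>The descent \<open>b, a\<close> plays 21, and a 321 in \<open>q\<close>, lifted above
  all of \<open>u\<close>, would play 543. This serves the layers \<open>[2,1]\<close> and
  \<open>[3,2,1]\<close> alike.\<close>

lemma fibonacci_after_descent:
  assumes u: "is_perm u" "subseq [b,a] u" "a < b"
    and av: "u \<oplus> q \<in> Av A1"
  shows "fibonacci_perm q"
proof -
  have q: "q \<in> Av A1"
    using av u(1) by (rule Av_direct_sumD)
  then have "0 \<notin> set q"
    by (auto simp: Av_A1_iff is_perm_iff)
  have "\<not> contains_pattern q [3,2,1]"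
  proof
    assume "contains_pattern q [3,2,1]"
    then obtain x y z where xyz: "subseq [x,y,z] q" "z < y" "y < x"
      unfolding contains_321_iff by blast
    have "subseq ([b,a] @ map (\<lambda>i. i + length u) [x,y,z]) (u \<oplus> q)"
      unfolding direct_sum_def using u(2) xyz(1) by (intro list_emb_append_mono subseq_map)
    \<comment> \<open>Here \<open>b\<close> is at most \<open>length u\<close>, and \<open>z\<close>
      is at least \<open>1\<close> because \<open>q\<close> is a permutation.\<close>
    moreover have "b < z + length u"
      using u \<open>0 \<notin> set q\<close> subseq_setD[OF u(2), of b] subseq_setD[OF xyz(1), of z]
      by (cases z) (auto simp: is_perm_iff)
    ultimately have "contains_pattern (u \<oplus> q) [2,1,5,4,3]"
      using u(3) xyz(2,3) unfolding contains_21543_iff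
      by (intro exI[of _ b] exI[of _ a] exI[of _ "x + length u"] exI[of _ "y + length u"]
          exI[of _ "z + length u"]) simp
    with av show False
      by (simp add: Av_A1_iff)
  qed
  with q show ?thesis
    by (simp add: Av_A1_iff fibonacci_perm_iff)
qed

lemma Av_A1_decompose:
  assumes "p \<in> Av A1"
  shows "\<exists>\<pi> \<sigma> \<tau>. p = \<pi> \<oplus> \<sigma> \<oplus> \<tau> \<and> is_perm \<pi> \<and> sorted_wrt (<) \<pi> \<and>
       (\<sigma> = [] \<or> \<sigma> = [3,2,1]) \<and> fibonacci_perm \<tau>"
  using assms
proof (induction "length p" arbitrary: p rule: less_induct)
  case less
  note av = less.prems[unfolded Av_A1_iff]
  have Nil: "is_perm []"
    by (simp add: is_perm_iff)
  show ?case
  \<comment> \<open>Settling the Fibonacci case first, with \<pi> and \<sigma> empty, leaves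
    \<open>p\<close> with an occurrence of 321. This makes \<open>p\<close> nonempty and later
    excludes a first layer of length two.\<close>
  proof (cases "fibonacci_perm p")
    case True
    then show ?thesis
      using Nil by (intro exI[of _ "[]"] exI[of _ p]) simp
  next
    case False
    then have has321: "contains_pattern p [3,2,1]"
      using av by (simp add: fibonacci_perm_iff)
    then obtain x r where p: "p = x # r"
      unfolding contains_321_iff by (cases p) auto
    then obtain q where q: "p = rev [1..<Suc x] \<oplus> q"
      using first_layer av by metis
    have "x \<noteq> 0"
      using av p by (metis atLeastAtMost_iff is_perm_iff list.set_intros(1) not_one_le_zero)
    have "x < 4"
    proof (rule ccontr)
      assume "\<not> x < 4"
      then obtain m where m: "x = 4 + m"
        by (metis le_Suc_ex not_less)
      \<comment> \<open>These are the first four entries of the layer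
        \<open>rev [1..<Suc x]\<close>.\<close>
      then have "subseq [m + 4, m + 3, m + 2, m + 1] p"
        by (simp add: q direct_sum_def eval_nat_numeral)
      then have "contains_pattern p [4,3,2,1]"
        unfolding contains_4321_iff by (intro exI conjI) auto
      with av show False
        by blast
    qed
    then consider "x = 1" | "x = 2" | "x = 3"
      using \<open>x \<noteq> 0\<close> by linarith
    then show ?thesis
    proof cases
      case 1
      then have q: "p = [1] \<oplus> q"
        using q by simp
      moreover have one: "is_perm [1]"
        by (simp add: is_perm_iff)
      ultimately have "q \<in> Av A1" "length q < length p"
        using less.prems Av_direct_sumD by auto
      then obtain \<pi> \<sigma> \<tau> where "q = \<pi> \<oplus> \<sigma> \<oplus> \<tau>" "is_perm \<pi>" "sorted_wrt (<) \<pi>"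
        "\<sigma> = [] \<or> \<sigma> = [3,2,1]" "fibonacci_perm \<tau>"
        using less.hyps by blast
      \<comment> \<open>Prepending the layer \<open>[1]\<close> keeps the first summand increasing;
        \<sigma> and \<tau> are inherited from \<open>q\<close>.\<close>
      moreover from this have "sorted_wrt (<) ([1] \<oplus> \<pi>)" "is_perm ([1] \<oplus> \<pi>)"
        using is_perm_Cons_1 by (auto simp: direct_sum_def sorted_wrt_map is_perm_iff)
      ultimately show ?thesis
        using q by (metis direct_sum_assoc)
    next
      case 2
      then have q: "p = [2,1] \<oplus> q"
        using q by (simp add: numeral_2_eq_2)
      have two: "is_perm [2,1]"
        by (auto simp: is_perm_iff)
      then have "fibonacci_perm q"
        using less.prems q by (intro fibonacci_after_descent[of "[2,1]" 2 1]) simp_all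
      \<comment> \<open>This case is contradictory: \<open>q\<close> avoids 321, while the 321 in
        \<open>p\<close> can use neither \<open>2\<close> nor \<open>1\<close>, since the shifted
        entries of \<open>q\<close> are at least \<open>2\<close>.\<close>
      then have "\<not> contains_pattern (map (\<lambda>y. y + 2) q) [3,2,1]"
        unfolding contains_pattern_shift fibonacci_perm_iff by blast
      moreover obtain a b c where "subseq [a,b,c] (2 # 1 # map (\<lambda>y. y + 2) q)" "c < b" "b < a"
        using has321 unfolding q direct_sum_def contains_321_iff by auto
      moreover from this have "subseq [a,b,c] (map (\<lambda>y. y + 2) q)"
        using subseq_setD[of "[b,c]" "map (\<lambda>y. y + 2) q" c]
          subseq_setD[of "[c]" "map (\<lambda>y. y + 2) q" c]
        by (auto split: if_split_asm)
      ultimately show ?thesis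
        unfolding contains_321_iff by blast
    next
      case 3
      then have q: "p = [3,2,1] \<oplus> q"
        using q by (simp add: numeral_3_eq_3 numeral_2_eq_2)
      have three: "is_perm [3,2,1]"
        by (auto simp: is_perm_iff)
      then have "fibonacci_perm q"
        using less.prems q by (intro fibonacci_after_descent[of "[3,2,1]" 2 1]) simp_all
      then show ?thesis
        using Nil q by (intro exI[of _ "[]"] exI[of _ "[3,2,1]"] exI[of _ q]) simp
    qed
  qed
qed

theorem theorem2p2:
  fixes p :: "nat list"
  assumes "is_perm p"
  shows "p \<in> Av A1 \<longleftrightarrow>
    (\<exists>\<pi> \<sigma> \<tau>. p = \<pi> \<oplus> \<sigma> \<oplus> \<tau> \<and>
       is_perm \<pi> \<and> sorted_wrt (<) \<pi> \<and>
       (\<sigma> = [] \<or> \<sigma> = [3,2,1]) \<and>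
       fibonacci_perm \<tau>)"
proof
  assume "\<exists>\<pi> \<sigma> \<tau>. p = \<pi> \<oplus> \<sigma> \<oplus> \<tau> \<and> is_perm \<pi> \<and> sorted_wrt (<) \<pi> \<and>
       (\<sigma> = [] \<or> \<sigma> = [3,2,1]) \<and> fibonacci_perm \<tau>"
  then obtain \<pi> \<sigma> \<tau> where p: "p = \<pi> \<oplus> (\<sigma> \<oplus> \<tau>)" and \<pi>: "is_perm \<pi>" "sorted_wrt (<) \<pi>"
    and \<sigma>: "\<sigma> = [] \<or> \<sigma> = [3,2,1]" and \<tau>: "fibonacci_perm \<tau>"
    by (auto simp: direct_sum_assoc)
  have "\<not> contains_pattern p s" if "s \<in> A1" for s
  proof
    assume "contains_pattern p s"
    \<comment> \<open>The index \<open>2\<close> serves 231, and the index \<open>1\<close> serves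
      the other three patterns.\<close>
    moreover have "\<exists>j < length s. s ! j < s ! 0"
      using that by (auto simp: A1_def intro: exI[of _ "1 :: nat"] exI[of _ "2 :: nat"])
    ultimately have "contains_pattern (\<sigma> \<oplus> \<tau>) s"
      using contains_pattern_increasing_sum \<pi> p by blast
    then show False
      using \<sigma> that sum_321_fibonacci_avoids[OF \<tau>] fibonacci_imp_Av_A1[OF \<tau>]
      by (auto simp: Av_def)
  qed
  with assms show "p \<in> Av A1"
    by (simp add: Av_def)
qed (rule Av_A1_decompose)

end
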